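(* For the cake-cutting share, $\alpha(\cdot,m)=O(m^{2/3})$; further, there exist fair division instances showing that $\alpha(\cdot,m)=\Omega(\sqrt{m})$. That is, there are absolute constants $K,c>0$ such that, for all integers $m\ge1$: (i) for every $n\ge 1$ and every fair division instance $\mathcal{I}=\langle [n],[m],V\rangle$ there is an allocation $\mathcal{A}=(A_1,\dots,A_n)\in\mathcal{P}(n,m)$ with $u_i(A_i)\ge \frac{1}{K m^{2/3}}\,\mathrm{CCS}_i(\mathcal{I})$ for all $i\in[n]$; (ii) there is a fair division instance $\mathcal{I}=\langle [n],[m],V\rangle$ (for some $n$) such that whenever $\alpha\ge 1$ and an allocation $\mathcal{A}\in\mathcal{P}(n,m)$ satisfy $u_i(A_i)\ge \mathrm{CCS}_i(\mathcal{I})/\alpha$ for all $i\in[n]$, then $\alpha\ge c\sqrt{m}$.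
   Context: A fair division instance $\mathcal{I}=\langle [n],[m],V\rangle$ consists of $n$ agents, $m$ homogeneous divisible items, and valuations $V=(v_1,\dots,v_n)$, where $v_{ik}\ge 0$ is agent $i$'s value for all of item $k$. A bundle is a vector $B\in[0,1]^m$, and $u_i(B)=\sum_{k\in[m]} v_{ik}B(k)$. An allocation is a tuple $\mathcal{A}=(A_1,\dots,A_n)$ of bundles with $\sum_{i\in[n]}A_i(k)\le 1$ for every $k\in[m]$; $\mathcal{P}(n,m)$ is the set of all allocations. Cake-cutting share: $\mathrm{CCS}_i(\mathcal{I})=\max u_i(A_i)$ over all $\mathcal{A}\in\mathcal{P}(n,m)$ such that $u_j(A_i)\le u_j(A_{j'})$ for all $j,j'\in[n]\setminus\{i\}$. $\alpha(n,m)$ is the smallest $\alpha\ge1$ such that every instance with $n$ agents and $m$ items has an allocation with $u_i(A_i)\ge \mathrm{CCS}_i(\mathcal{I})/\alpha$ for all $i$; $\alpha(\cdot,m)$ is the worst case (supremum) of $\alpha(n,m)$ over all $n$. *)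

theory Defs
  imports "HOL-Analysis.Analysis"
begin

text \<open>
  Agents are indexed by \<open>{1..n}\<close> and items by \<open>{1..m}\<close>; \<open>v i k\<close> is agent \<open>i\<close>'s value for all
  of item \<open>k\<close>. A bundle is a function on item indices; its values outside \<open>{1..m}\<close> are
  irrelevant, as are the bundles of an allocation outside \<open>{1..n}\<close>.
\<close>

definition fair_division_instance :: "nat \<Rightarrow> nat \<Rightarrow> (nat \<Rightarrow> nat \<Rightarrow> real) \<Rightarrow> bool" where
  "fair_division_instance n m v \<longleftrightarrow> n \<ge> 1 \<and> m \<ge> 1 \<and> (\<forall>i\<in>{1..n}. \<forall>k\<in>{1..m}. v i k \<ge> 0)"

definition is_bundle :: "nat \<Rightarrow> (nat \<Rightarrow> real) \<Rightarrow> bool" where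
  "is_bundle m B \<longleftrightarrow> (\<forall>k\<in>{1..m}. 0 \<le> B k \<and> B k \<le> 1)"

definition utility :: "nat \<Rightarrow> (nat \<Rightarrow> nat \<Rightarrow> real) \<Rightarrow> nat \<Rightarrow> (nat \<Rightarrow> real) \<Rightarrow> real" where
  "utility m v i B = (\<Sum>k\<in>{1..m}. v i k * B k)"

definition allocations :: "nat \<Rightarrow> nat \<Rightarrow> (nat \<Rightarrow> nat \<Rightarrow> real) set" where
  "allocations n m =
     {A. (\<forall>i\<in>{1..n}. is_bundle m (A i)) \<and> (\<forall>k\<in>{1..m}. (\<Sum>i\<in>{1..n}. A i k) \<le> 1)}"

definition ccs_feasible ::
    "nat \<Rightarrow> nat \<Rightarrow> (nat \<Rightarrow> nat \<Rightarrow> real) \<Rightarrow> nat \<Rightarrow> (nat \<Rightarrow> nat \<Rightarrow> real) set" where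
  "ccs_feasible n m v i =
     {A \<in> allocations n m.
        \<forall>j\<in>{1..n} - {i}. \<forall>j'\<in>{1..n} - {i}. utility m v j (A i) \<le> utility m v j (A j')}"

text \<open>
  The cake-cutting share is a maximum; it is written as a supremum, and the lemma
  \<open>CCS_is_maximum\<close> below shows that the supremum is attained.
\<close>

definition CCS :: "nat \<Rightarrow> nat \<Rightarrow> (nat \<Rightarrow> nat \<Rightarrow> real) \<Rightarrow> nat \<Rightarrow> real" where
  "CCS n m v i = (SUP A\<in>ccs_feasible n m v i. utility m v i (A i))"

lemma CCS_is_maximum:
  assumes i: "i \<in> {1..n}"
  shows "\<exists>A\<in>ccs_feasible n m v i. CCS n m v i = utility m v i (A i) \<and>
           (\<forall>A'\<in>ccs_feasible n m v i. utility m v i (A' i) \<le> utility m v i (A i))"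
proof -
  define R :: "nat \<Rightarrow> nat \<Rightarrow> real set" where
    "R j k = (if j \<in> {1..n} \<and> k \<in> {1..m} then {0..1} else {0})" for j k
  define Q :: "(nat \<Rightarrow> nat \<Rightarrow> real) set" where "Q = PiE UNIV (\<lambda>j. PiE UNIV (R j))"
  have comp: "compact (PiE UNIV S)" if "\<And>j. compact (S j)"
    for S :: "nat \<Rightarrow> 'z::topological_space set"
  proof -
    have "compactin (product_topology (\<lambda>_::nat. euclidean :: 'z topology) UNIV) (PiE UNIV S)"
      using that by (simp add: compactin_PiE)
    then show ?thesis by (simp add: euclidean_product_topology)
  qed
  have "compact Q"
    unfolding Q_def by (intro comp) (auto simp: R_def)
  define C where "C = Q \<inter> ccs_feasible n m v i"
  have cc: "continuous_on UNIV (\<lambda>A::nat \<Rightarrow> nat \<Rightarrow> real. A j k)" for j k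
    by (rule continuous_on_product_then_coordinatewise[where i = k],
        rule continuous_on_product_then_coordinatewise[where i = j], rule continuous_on_id)
  have cu: "continuous_on UNIV (\<lambda>A::nat \<Rightarrow> nat \<Rightarrow> real. utility m v j (A l))" for j l
    unfolding utility_def by (intro continuous_intros cc)
  have "closed (ccs_feasible n m v i)"
    unfolding ccs_feasible_def allocations_def is_bundle_def Ball_def mem_Collect_eq
    by (intro closed_Collect_conj closed_Collect_all closed_Collect_imp closed_Collect_le
          open_Collect_const continuous_intros cc cu)
  with \<open>compact Q\<close> have "compact C" unfolding C_def by (rule compact_Int_closed)
  moreover have "(\<lambda>_ _. 0) \<in> C"
    by (auto simp: C_def Q_def R_def ccs_feasible_def allocations_def is_bundle_def utility_def)
  ultimately obtain A where A: "A \<in> C"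
    "\<And>A'. A' \<in> C \<Longrightarrow> utility m v i (A' i) \<le> utility m v i (A i)"
    using continuous_attains_sup[of C "\<lambda>A. utility m v i (A i)"] cu continuous_on_subset
    by (metis empty_iff subset_UNIV)
  have le: "utility m v i (A' i) \<le> utility m v i (A i)" if A': "A' \<in> ccs_feasible n m v i" for A'
  proof -
    define T where "T j k = (if j \<in> {1..n} \<and> k \<in> {1..m} then A' j k else 0)" for j k
    have u: "utility m v l (T j) = utility m v l (A' j)" if "j \<in> {1..n}" for l j
      using that by (auto simp: utility_def T_def intro!: sum.cong)
    have s: "(\<Sum>j\<in>{1..n}. T j k) = (\<Sum>j\<in>{1..n}. A' j k)" if "k \<in> {1..m}" for k
      using that by (auto simp: T_def intro!: sum.cong)
    have al: "T \<in> allocations n m"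
      using A' s by (auto simp: ccs_feasible_def allocations_def is_bundle_def T_def)
    have "T \<in> ccs_feasible n m v i"
      using A' al u i by (simp add: ccs_feasible_def)
    moreover have "T \<in> Q"
      using A' by (auto simp: Q_def R_def T_def ccs_feasible_def allocations_def is_bundle_def)
    ultimately have "T \<in> C" by (simp add: C_def)
    from A(2)[OF this] u[OF i] show ?thesis by simp
  qed
  have "A \<in> ccs_feasible n m v i" using A(1) by (simp add: C_def)
  moreover from this have "CCS n m v i = utility m v i (A i)"
    unfolding CCS_def using le by (intro cSup_eq_maximum) auto
  ultimately show ?thesis using le by blast
qed

end

theory Submission
  imports Defs "HOL-Algebra.Algebraic_Closure_Type" "HOL-Library.Z2"
begin

text \<open>
  Upper bound (it yields \<open>O(\<surd>m)\<close>, stronger than needed). Scale every agent's values to total \<open>n\<close>.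
  If the bundle \<open>B\<^sub>i\<close> attains the share \<open>c\<^sub>i\<close> of agent \<open>i\<close>, then every other agent values \<open>B\<^sub>i\<close> at
  most \<open>1\<close>. Half of every item is split equally, which serves the agents with \<open>c\<^sub>i < L = \<surd>(2m)\<close>. The
  other half is split among the remaining \<open>N\<close> agents in proportion to the \<open>B\<^sub>i\<close>; by Jensen this
  gives agent \<open>i\<close> at least about \<open>c\<^sub>i\<^sup>2 / (c\<^sub>i + N)\<close>. Finally \<open>N \<le> 2m\<close>: the matrix of the values of the
  \<open>B\<^sub>j\<close> for agent \<open>i\<close>, divided by \<open>c\<^sub>i\<close>, has rank at most \<open>m\<close>, unit diagonal and off-diagonal entries at
  most \<open>1/L\<close>, so \<open>tr\<^sup>2 \<le> rank * Frobenius\<^sup>2\<close> bounds its size.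

  Lower bound: the agents are the \<open>q\<^sup>2\<close> non-vertical lines of the affine plane over a field with
  \<open>q = 2 ^ k\<close> elements, the items are its points and one extra item that brings every agent's total
  value up to \<open>q\<^sup>2\<close>. Lines meet in at most one point, so each share is at least \<open>q\<close>, whereas the average
  utility in an allocation is at most \<open>2\<close>. Powers of two are dense enough to reach every \<open>m\<close> up to a
  constant factor.
\<close>

section \<open>Trace, rank and Frobenius norm\<close>

text \<open>The inner sums are the entries of a product of an \<open>I\<close> by \<open>K\<close>
  and a \<open>K\<close> by \<open>I\<close> matrix, so \<open>card K\<close> bounds the rank.
  Induction on \<open>K\<close> splits off one rank-one summand at a time, orthogonally to the rest,
  so that squared Frobenius norms add while traces are controlled by Cauchy-Schwarz.\<close>

lemma trace_squared_le_rank_times_frobenius: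
  fixes x y :: "'k \<Rightarrow> 'i \<Rightarrow> real"
  assumes "finite K" "finite I"
  shows "(\<Sum>i\<in>I. \<Sum>k\<in>K. x k i * y k i)\<^sup>2
    \<le> real (card K) * (\<Sum>i\<in>I. \<Sum>j\<in>I. (\<Sum>k\<in>K. x k i * y k j)\<^sup>2)"
  using assms(1)
proof (induction K arbitrary: x rule: finite_induct)
  case empty
  then show ?case by simp
next
  case (insert a K)
  define M where "M i j = (\<Sum>k\<in>insert a K. x k i * y k j)" for i j
  define r where "r = (\<Sum>i\<in>I. (x a i)\<^sup>2)"
  show ?case
  proof (cases "r = 0")
    \<comment> \<open>Here \<open>x a\<close> vanishes on \<open>I\<close>, so there is no direction
      to project along, and the summand \<open>a\<close> contributes nothing.\<close>
    case True
    then have x0: "x a i = 0" if "i \<in> I" for i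
      using that assms(2) by (simp add: r_def sum_nonneg_eq_0_iff)
    have "(\<Sum>i\<in>I. \<Sum>k\<in>K. x k i * y k i)\<^sup>2
        \<le> real (card K) * (\<Sum>i\<in>I. \<Sum>j\<in>I. (\<Sum>k\<in>K. x k i * y k j)\<^sup>2)"
      by (rule insert.IH)
    also have "\<dots> \<le> real (card (insert a K)) * (\<Sum>i\<in>I. \<Sum>j\<in>I. (\<Sum>k\<in>K. x k i * y k j)\<^sup>2)"
      using insert.hyps by (intro mult_right_mono sum_nonneg) auto
    finally show ?thesis
      using insert.hyps x0 by simp
  next
    case False
    then have r: "r > 0"
      by (metis r_def less_eq_real_def sum_nonneg zero_le_power2)
    \<comment> \<open>Projecting the columns of \<open>M\<close> onto the orthogonal complement of \<open>x a\<close> removes the summand \<open>a\<close>.\<close>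
    define d where "d j = (\<Sum>i\<in>I. x a i * M i j) / r" for j
    define x' where "x' k i = x k i - x a i * ((\<Sum>l\<in>I. x a l * x k l) / r)" for k i
    define M' where "M' i j = (\<Sum>k\<in>K. x' k i * y k j)" for i j
    have xa: "x' a i = 0" for i
      using r by (simp add: x'_def r_def power2_eq_square)
    have M': "M' i j = M i j - x a i * d j" for i j
    proof -
      have "M' i j = (\<Sum>k\<in>insert a K. x' k i * y k j)"
        using insert.hyps by (simp add: M'_def xa)
      also have "\<dots> = M i j - x a i * ((\<Sum>k\<in>insert a K. \<Sum>l\<in>I. x a l * (x k l * y k j)) / r)"
        by (simp add: x'_def M_def algebra_simps sum_subtractf sum_distrib_left
            sum_distrib_right sum_divide_distrib del: sum.insert)
      also have "(\<Sum>k\<in>insert a K. \<Sum>l\<in>I. x a l * (x k l * y k j)) = (\<Sum>l\<in>I. x a l * M l j)"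
        by (subst sum.swap) (simp add: M_def sum_distrib_left del: sum.insert)
      finally show ?thesis by (simp add: d_def)
    qed
    have orth: "(\<Sum>i\<in>I. x a i * M' i j) = 0" for j
    proof -
      have "(\<Sum>i\<in>I. x a i * M' i j) = (\<Sum>i\<in>I. x a i * M i j) - r * d j"
        by (simp add: M' algebra_simps sum_subtractf r_def power2_eq_square sum_distrib_left)
      then show ?thesis using r by (simp add: d_def)
    qed
    \<comment> \<open>Pythagoras in column \<open>j\<close>, which is \<open>d j\<close> times
      \<open>x a\<close> plus the orthogonal remainder \<open>M'\<close>.\<close>
    have col: "(\<Sum>i\<in>I. (M i j)\<^sup>2) = r * (d j)\<^sup>2 + (\<Sum>i\<in>I. (M' i j)\<^sup>2)" for j
    proof -
      have "(\<Sum>i\<in>I. (M i j)\<^sup>2) = (\<Sum>i\<in>I. (x a i)\<^sup>2 * (d j)\<^sup>2 + 2 * d j * (x a i * M' i j) + (M' i j)\<^sup>2)"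
        by (intro sum.cong refl) (simp add: M' power2_eq_square algebra_simps)
      also have "\<dots> = r * (d j)\<^sup>2 + 2 * d j * (\<Sum>i\<in>I. x a i * M' i j) + (\<Sum>i\<in>I. (M' i j)\<^sup>2)"
        by (simp add: sum.distrib r_def sum_distrib_left sum_distrib_right)
      finally show ?thesis by (simp add: orth)
    qed
    define P where "P = r * (\<Sum>j\<in>I. (d j)\<^sup>2)"
    define Q where "Q = (\<Sum>i\<in>I. \<Sum>j\<in>I. (M' i j)\<^sup>2)"
    define s where "s = (\<Sum>i\<in>I. x a i * d i)"
    define t where "t = (\<Sum>i\<in>I. M' i i)"
    define n where "n = real (card K)"
    have s: "s\<^sup>2 \<le> P"
      unfolding s_def P_def r_def by (rule Cauchy_Schwarz_ineq_sum)
    have t: "t\<^sup>2 \<le> n * Q"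
      unfolding t_def Q_def n_def M'_def by (rule insert.IH)
    have "(\<Sum>i\<in>I. \<Sum>j\<in>I. (M i j)\<^sup>2) = (\<Sum>j\<in>I. r * (d j)\<^sup>2 + (\<Sum>i\<in>I. (M' i j)\<^sup>2))"
      by (subst sum.swap) (simp add: col)
    also have "\<dots> = P + Q"
      using sum.swap[of "\<lambda>i j. (M' i j)\<^sup>2" I I]
      by (simp add: P_def Q_def sum.distrib sum_distrib_left)
    finally have PQ: "(\<Sum>i\<in>I. \<Sum>j\<in>I. (M i j)\<^sup>2) = P + Q" .
    have tr: "(\<Sum>i\<in>I. M i i) = s + t"
      by (simp add: s_def t_def M' flip: sum.distrib)
    have n0: "n \<ge> 0" and Q0: "Q \<ge> 0"
      by (auto simp: n_def Q_def intro!: sum_nonneg)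
    have "(s + t)\<^sup>2 \<le> (n + 1) * (P + Q)"
    proof (cases "n = 0")
      case True
      then show ?thesis using s t Q0 by simp
    next
      case False
      \<comment> \<open>Weighted Cauchy-Schwarz for \<open>s + t\<close> with weights 1 and
        \<open>n\<close>, written as an identity with a square as the defect. The case
        \<open>n = 0\<close> is separate because there \<open>t\<close> is forced to be 0.\<close>
      have "n * (s + t)\<^sup>2 + (n * s - t)\<^sup>2 = (n + 1) * (n * s\<^sup>2 + t\<^sup>2)"
        by (simp add: power2_eq_square algebra_simps)
      then have "n * (s + t)\<^sup>2 \<le> (n + 1) * (n * s\<^sup>2 + t\<^sup>2)"
        using zero_le_power2[of "n * s - t"] by linarith
      also have "\<dots> \<le> (n + 1) * (n * P + n * Q)"
        using s t n0 by (intro mult_left_mono add_mono) auto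
      also have "\<dots> = n * ((n + 1) * (P + Q))"
        by (simp add: algebra_simps)
      finally show ?thesis
        using False n0 by simp
    qed
    then have "(\<Sum>i\<in>I. M i i)\<^sup>2 \<le> real (card (insert a K)) * (\<Sum>i\<in>I. \<Sum>j\<in>I. (M i j)\<^sup>2)"
      using insert.hyps by (simp add: tr PQ n_def add.commute)
    then show ?thesis by (simp only: M_def)
  qed
qed

text \<open>Dividing each row by its diagonal sum gives trace \<open>N = card I\<close> and squared
  Frobenius norm at most \<open>N + N^2 / L^2\<close>. Since \<open>card K\<close> is at most
  \<open>L^2 / 2\<close>, the trace inequality becomes
  \<open>N^2 \<le> N * card K + N^2 / 2\<close>.\<close>

lemma card_le_if_nearly_biorthogonal:
  fixes S B :: "'i \<Rightarrow> 'k \<Rightarrow> real"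
  assumes fin: "finite I" "finite K"
    and diag: "\<And>i. i \<in> I \<Longrightarrow> L \<le> (\<Sum>k\<in>K. S i k * B i k)"
    and off: "\<And>i j. i \<in> I \<Longrightarrow> j \<in> I \<Longrightarrow> i \<noteq> j \<Longrightarrow>
      0 \<le> (\<Sum>k\<in>K. S i k * B j k) \<and> (\<Sum>k\<in>K. S i k * B j k) \<le> 1"
    and L: "L > 0" "2 * real (card K) \<le> L\<^sup>2"
  shows "real (card I) \<le> 2 * real (card K)"
proof -
  define c where "c i = (\<Sum>k\<in>K. S i k * B i k)" for i
  define M where "M i j = (\<Sum>k\<in>K. S i k / c i * B j k)" for i j
  define N where "N = real (card I)"
  have M_eq: "M i j = (\<Sum>k\<in>K. S i k * B j k) / c i" for i j
    by (simp add: M_def sum_divide_distrib)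
  have c: "c i \<ge> L" if "i \<in> I" for i
    using diag that by (simp add: c_def)
  have M1: "M i i = 1" if "i \<in> I" for i
    using c[OF that] L by (simp add: M_eq flip: c_def)
  have entry: "(M i j)\<^sup>2 \<le> (if i = j then 1 else 0) + 1 / L\<^sup>2" if "i \<in> I" "j \<in> I" for i j
  proof (cases "i = j")
    case True
    then show ?thesis using M1 that by simp
  next
    case False
    have "0 \<le> M i j" "M i j \<le> 1 / L"
      using off[OF that False] c[OF that(1)] L by (auto simp: M_eq intro!: frac_le)
    then have "(M i j)\<^sup>2 \<le> (1 / L)\<^sup>2"
      by (intro power_mono)
    then show ?thesis
      using False by (simp add: power_divide)
  qed
  have "N\<^sup>2 = (\<Sum>i\<in>I. M i i)\<^sup>2"
    using M1 by (simp add: N_def)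
  also have "\<dots> \<le> real (card K) * (\<Sum>i\<in>I. \<Sum>j\<in>I. (M i j)\<^sup>2)"
    unfolding M_def
    using trace_squared_le_rank_times_frobenius[OF fin(2,1), of "\<lambda>k i. S i k / c i" "\<lambda>k j. B j k"]
    by simp
  also have "\<dots> \<le> real (card K) * (\<Sum>i\<in>I. \<Sum>j\<in>I. (if i = j then 1 else 0) + 1 / L\<^sup>2)"
    using entry by (intro mult_left_mono sum_mono) auto
  also have "\<dots> = N * (real (card K) + N * (real (card K) / L\<^sup>2))"
    using fin by (simp add: sum.distrib N_def algebra_simps)
  also have "\<dots> \<le> N * (real (card K) + N * (1 / 2))"
    using L by (intro mult_left_mono add_left_mono) (auto simp: N_def field_simps)
  finally have "N * N \<le> N * (real (card K) + N / 2)"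
    by (simp add: power2_eq_square)
  then show ?thesis
    by (cases "N = 0") (auto simp: N_def mult_le_cancel_left split: if_splits)
qed

section \<open>Dividing items in proportion to desired bundles\<close>

text \<open>Jensen for the convex function \<open>1 / \<beta>\<close> with weights
  \<open>s k * B i k\<close>, carried out through its tangent at \<open>\<beta> = 1 + L\<close>.
  With \<open>c\<close> the own value, the weighted mean of \<open>\<beta>\<close> is at most
  \<open>(c + card I) / c\<close>, hence at most \<open>1 + L\<close> because
  \<open>card I \<le> L^2 \<le> c * L\<close>.\<close>

lemma proportional_sharing:
  fixes B :: "'i \<Rightarrow> 'k \<Rightarrow> real" and s :: "'k \<Rightarrow> real"
  assumes fin: "finite I" "finite K" and i: "i \<in> I"
    and s: "\<And>k. k \<in> K \<Longrightarrow> 0 \<le> s k"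
    and B: "\<And>j k. j \<in> I \<Longrightarrow> k \<in> K \<Longrightarrow> 0 \<le> B j k \<and> B j k \<le> 1"
    and own: "L \<le> (\<Sum>k\<in>K. s k * B i k)"
    and others: "\<And>j. j \<in> I \<Longrightarrow> j \<noteq> i \<Longrightarrow> (\<Sum>k\<in>K. s k * B j k) \<le> 1"
    and L: "L > 0" "real (card I) \<le> L\<^sup>2"
  shows "(\<Sum>k\<in>K. s k * (B i k / (\<Sum>j\<in>I. B j k))) \<ge> (\<Sum>k\<in>K. s k * B i k) / (1 + L)"
proof -
  define \<beta> where "\<beta> k = (\<Sum>j\<in>I. B j k)" for k
  define c where "c = (\<Sum>k\<in>K. s k * B i k)"
  define t where "t = 1 / (1 + L)"
  have summand: "s k * (B i k / \<beta> k) \<ge> 2 * t * (s k * B i k) - t\<^sup>2 * (s k * B i k * \<beta> k)"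
    if k: "k \<in> K" for k
  \<comment> \<open>If \<open>B i k = 0\<close>, both sides are 0, even when
    \<open>\<beta> k = 0\<close>, where division yields 0.\<close>
  proof (cases "B i k = 0")
    case False
    then have "0 < B i k" using B[OF i k] by auto
    also have "B i k \<le> \<beta> k"
      unfolding \<beta>_def using fin i B k by (intro member_le_sum) auto
    finally have \<beta>: "\<beta> k > 0" .
    \<comment> \<open>This square is the gap between \<open>1 / \<beta> k\<close> and the tangent
      line at \<open>1 / t\<close>.\<close>
    have "0 \<le> (1 - t * \<beta> k)\<^sup>2 / \<beta> k" using \<beta> by simp
    also have "\<dots> = 1 / \<beta> k - (2 * t - t\<^sup>2 * \<beta> k)"
      using \<beta> by (simp add: field_simps power2_eq_square)
    finally have "s k * B i k * (2 * t - t\<^sup>2 * \<beta> k) \<le> s k * B i k * (1 / \<beta> k)"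
      using s[OF k] B[OF i k] by (intro mult_left_mono) auto
    then show ?thesis by (simp add: algebra_simps)
  qed simp
  have "(\<Sum>k\<in>K. s k * B i k * \<beta> k) = (\<Sum>j\<in>I. \<Sum>k\<in>K. s k * B i k * B j k)"
    unfolding \<beta>_def sum_distrib_left by (rule sum.swap)
  also have "\<dots> \<le> (\<Sum>j\<in>I. (if j = i then c else 0) + 1)"
  proof (intro sum_mono)
    fix j assume j: "j \<in> I"
    show "(\<Sum>k\<in>K. s k * B i k * B j k) \<le> (if j = i then c else 0) + 1"
    proof (cases "j = i")
      case True
      have "(\<Sum>k\<in>K. s k * B i k * B i k) \<le> c"
        unfolding c_def using s B[OF i] by (intro sum_mono mult_left_le) auto
      then show ?thesis using True by simp
    next
      case False
      have "(\<Sum>k\<in>K. s k * B i k * B j k) \<le> (\<Sum>k\<in>K. s k * B j k)"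
        using s B[OF i] B[OF j] by (intro sum_mono mult_right_mono mult_left_le) auto
      then show ?thesis using others[OF j False] False by simp
    qed
  qed
  also have "\<dots> = c + card I"
    using fin i by (simp add: sum.distrib)
  also have "\<dots> \<le> c + c * L"
    using mult_right_mono[OF own, of L] L unfolding c_def[symmetric] power2_eq_square by linarith
  finally have le: "(\<Sum>k\<in>K. s k * B i k * \<beta> k) \<le> c * (1 + L)"
    by (simp add: algebra_simps)
  have "t * (1 + L) = 1" using L by (simp add: t_def)
  then have "t\<^sup>2 * (c * (1 + L)) = t * c"
    by (metis mult.assoc mult.commute mult.right_neutral power2_eq_square)
  then have "c / (1 + L) = 2 * t * c - t\<^sup>2 * (c * (1 + L))"
    by (simp add: t_def)
  also have "\<dots> \<le> 2 * t * c - t\<^sup>2 * (\<Sum>k\<in>K. s k * B i k * \<beta> k)"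
    using le by (intro diff_left_mono mult_left_mono) auto
  also have "\<dots> = (\<Sum>k\<in>K. 2 * t * (s k * B i k) - t\<^sup>2 * (s k * B i k * \<beta> k))"
    by (simp add: c_def sum_subtractf sum_distrib_left)
  also have "\<dots> \<le> (\<Sum>k\<in>K. s k * (B i k / \<beta> k))"
    by (intro sum_mono summand)
  finally show ?thesis by (simp add: c_def \<beta>_def)
qed

section \<open>The field with \<open>2 ^ k\<close> elements\<close>

lemma char_two_add_self: "x + x = (0 :: bit alg_closure)"
proof -
  have "(1 :: bit alg_closure) + 1 = to_ac (1 + 1)"
    unfolding to_ac_add by simp
  then have "(1 :: bit alg_closure) + 1 = 0" by simp
  then show ?thesis
    by (metis distrib_left mult.right_neutral mult_zero_right)
qed

lemma frobenius_power_add: "(x + y) ^ (2 ^ k) = x ^ (2 ^ k) + (y :: bit alg_closure) ^ (2 ^ k)"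
proof (induction k)
  case (Suc k)
  have sq: "(a + b)\<^sup>2 = a\<^sup>2 + b\<^sup>2" for a b :: "bit alg_closure"
  proof -
    have "(a + b)\<^sup>2 = a\<^sup>2 + b\<^sup>2 + (a * b + a * b)"
      by (simp add: power2_eq_square algebra_simps)
    then show ?thesis by (simp add: char_two_add_self)
  qed
  show ?case
    unfolding power_Suc2 power_mult Suc.IH sq ..
qed simp

text \<open>For positive \<open>k\<close>, the finite field of order \<open>2 ^ k\<close>, realised
  in the algebraic closure of the two-element field as the fixed points of the \<open>k\<close>-th
  iterate of Frobenius.\<close>

definition binary_subfield :: "nat \<Rightarrow> bit alg_closure set" where
  "binary_subfield k = {x. x ^ (2 ^ k) = x}"

text \<open>The elements are the roots of a polynomial of degree \<open>2 ^ k\<close> that splits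
  over the algebraic closure; its derivative is 1, so all roots are simple.\<close>

lemma card_binary_subfield:
  assumes "k \<ge> 1"
  shows "card (binary_subfield k) = 2 ^ k"
proof -
  \<comment> \<open>This is \<open>X ^ (2 ^ k) - X\<close>, as signs do not matter in characteristic
    two.\<close>
  define p :: "bit alg_closure poly" where "p = Polynomial.monom 1 (2 ^ k) + Polynomial.monom 1 1"
  have k2: "1 < (2::nat) ^ k" using assms by (intro one_less_power) auto
  have neg: "a + b = 0 \<longleftrightarrow> a = b" for a b :: "bit alg_closure"
    by (metis char_two_add_self add_left_imp_eq)
  have deg: "Polynomial.degree p = 2 ^ k"
    unfolding p_def using k2 by (subst degree_add_eq_left) (auto simp: degree_monom_eq)
  have p0: "p \<noteq> 0" using deg k2 by auto
  have roots: "binary_subfield k = {x. poly p x = 0}"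
    by (auto simp: binary_subfield_def p_def poly_monom neg)
  have two: "(of_nat (2 ^ k) :: bit alg_closure) = 0"
    using assms char_two_add_self[of 1] by (cases k) (auto simp: one_add_one)
  have pd: "pderiv p = 1"
    unfolding p_def pderiv_add pderiv_monom using two by (simp add: one_pCons monom_0)
  have ord: "Polynomial.order x p = 1" if x: "poly p x = 0" for x
  proof (rule ccontr)
    assume "Polynomial.order x p \<noteq> 1"
    moreover have "Polynomial.order x p \<noteq> 0" using x p0 by (simp add: order_root)
    ultimately have "2 \<le> Polynomial.order x p" by simp
    then have "[:-x, 1:] ^ 2 dvd p"
      using p0 by (simp add: order_divides)
    then obtain r where "p = [:-x, 1:] ^ 2 * r" by (rule dvdE)
    then have "pderiv p = [:-x, 1:] * pderiv ([:-x, 1:] * r) + [:-x, 1:] * r * pderiv [:-x, 1:]"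
      by (simp only: power2_eq_square mult.assoc pderiv_mult)
    then have "poly (pderiv p) x = 0"
      by (simp only: poly_add poly_mult) simp
    then show False using pd by simp
  qed
  obtain A where A: "size A = Polynomial.degree p" "p = Polynomial.smult (Polynomial.lead_coeff p) (\<Prod>x\<in>#A. [:-x, 1:])"
    using alg_closed_imp_factorization[OF p0] by blast
  have "proots (\<Prod>x\<in>#A. [:-x, 1:]) = A"
    by (induction A) (simp_all add: proots_mult prod_mset_zero_iff image_iff del: mult_pCons_left)
  then have "proots p = A"
    using A(2) p0 by (metis leading_coeff_0_iff proots_smult)
  then have "size (proots p) = 2 ^ k" using A(1) deg by simp
  also have "size (proots p) = (\<Sum>x\<in>set_mset (proots p). count (proots p) x)"
    by (rule size_multiset_overloaded_eq)
  also have "\<dots> = card {x. poly p x = 0}"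
    using p0 ord by simp
  finally show ?thesis by (simp add: roots)
qed

section \<open>Lines and points of an affine plane\<close>

lemma affine_plane_exists:
  assumes "k \<ge> 1" and q: "q = 2 ^ k"
  obtains R :: "nat \<Rightarrow> nat \<Rightarrow> bool" where
    "\<And>i. i \<in> {1..q\<^sup>2} \<Longrightarrow> card {p \<in> {1..q\<^sup>2}. R i p} = q"
    "\<And>i j. i \<in> {1..q\<^sup>2} \<Longrightarrow> j \<in> {1..q\<^sup>2} \<Longrightarrow> i \<noteq> j \<Longrightarrow>
      card {p \<in> {1..q\<^sup>2}. R i p \<and> R j p} \<le> 1"
proof -
  define F where "F = binary_subfield k"
  have cF: "card F = q" using card_binary_subfield assms by (simp add: F_def)
  have finF: "finite F" using cF q by (intro card_ge_0_finite) simp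
  have cl: "a * x + b \<in> F" if "a \<in> F" "b \<in> F" "x \<in> F" for a b x
    using that by (simp add: F_def binary_subfield_def frobenius_power_add power_mult_distrib)
  have "card (F \<times> F) = card {1..q\<^sup>2}"
    by (simp add: card_cartesian_product cF power2_eq_square)
  \<comment> \<open>The same \<open>g\<close> numbers the points, as coordinate pairs, and the
    non-vertical lines, as pairs of slope and intercept.\<close>
  then obtain g where g: "bij_betw g {1..q\<^sup>2} (F \<times> F)"
    using finF by (metis finite_same_card_bij finite_SigmaI finite_atLeastAtMost)
  define inc where "inc l p \<longleftrightarrow> snd p = fst l * fst p + snd l" for l p :: "bit alg_closure \<times> bit alg_closure"
  have tr: "card {p \<in> {1..q\<^sup>2}. P (g p)} = card {p \<in> F \<times> F. P p}" for P
  proof (rule bij_betw_same_card)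
    have "g ` {p \<in> {1..q\<^sup>2}. P (g p)} = {p \<in> g ` {1..q\<^sup>2}. P p}"
      by blast
    then have "g ` {p \<in> {1..q\<^sup>2}. P (g p)} = {p \<in> F \<times> F. P p}"
      using bij_betw_imp_surj_on[OF g] by simp
    then show "bij_betw g {p \<in> {1..q\<^sup>2}. P (g p)} {p \<in> F \<times> F. P p}"
      by (intro bij_betw_subset[OF g]) auto
  qed
  have 1: "card {p \<in> F \<times> F. inc l p} = q" if l: "l \<in> F \<times> F" for l
  proof -
    have "{p \<in> F \<times> F. inc l p} = (\<lambda>x. (x, fst l * x + snd l)) ` F"
      using l cl by (auto simp: inc_def)
    then show ?thesis
      by (simp add: card_image inj_on_def cF)
  qed
  have 2: "card {p \<in> F \<times> F. inc l p \<and> inc l' p} \<le> 1" if "l \<noteq> l'" for l l'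
  proof -
    \<comment> \<open>Subtracting the line equations at two common points gives slope difference
      times abscissa difference equal to 0; equal slopes would force equal intercepts and so equal
      lines.\<close>
    have "p = p'" if "inc l p" "inc l' p" "inc l p'" "inc l' p'" for p p'
    proof -
      have "(fst l - fst l') * (fst p - fst p')
          = (fst l * fst p + snd l) - (fst l' * fst p + snd l')
            - ((fst l * fst p' + snd l) - (fst l' * fst p' + snd l'))"
        by (simp add: algebra_simps)
      also have "\<dots> = 0"
        by (simp add: that[unfolded inc_def, symmetric])
      finally have "(fst l - fst l') * (fst p - fst p') = 0" .
      moreover have "fst l \<noteq> fst l'"
        using that \<open>l \<noteq> l'\<close> by (auto simp: inc_def prod_eq_iff)
      ultimately show ?thesis
        using that by (auto simp: inc_def prod_eq_iff)
    qed
    then show ?thesis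
      using finF by (auto simp: card_le_Suc0_iff_eq)
  qed
  show ?thesis
  proof (rule that[of "\<lambda>i p. inc (g i) (g p)"])
    fix i assume "i \<in> {1..q\<^sup>2}"
    then have "g i \<in> F \<times> F" using g by (rule bij_betw_apply[rotated])
    then show "card {p \<in> {1..q\<^sup>2}. inc (g i) (g p)} = q"
      using tr[of "inc (g i)"] 1 by simp
  next
    fix i j assume "i \<in> {1..q\<^sup>2}" "j \<in> {1..q\<^sup>2}" "i \<noteq> j"
    then have "g i \<noteq> g j" using g by (auto simp: bij_betw_def inj_on_def)
    then show "card {p \<in> {1..q\<^sup>2}. inc (g i) (g p) \<and> inc (g j) (g p)} \<le> 1"
      using tr[of "\<lambda>p. inc (g i) p \<and> inc (g j) p"] 2 by simp
  qed
qed

section \<open>Upper bound: an allocation within a factor of order \<open>sqrt m\<close>\<close>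

text \<open>Agent \<open>j\<close> finds none of the \<open>n\<close> bundles worth less than
  \<open>A i\<close>, while together they are worth at most the total value.\<close>

lemma ccs_feasible_utility_le:
  assumes A: "A \<in> ccs_feasible n m v i" and v: "fair_division_instance n m v"
    and i: "i \<in> {1..n}" and j: "j \<in> {1..n}" "j \<noteq> i"
  shows "real n * utility m v j (A i) \<le> (\<Sum>k\<in>{1..m}. v j k)"
proof -
  have al: "A \<in> allocations n m"
    and le: "\<And>j'. j' \<in> {1..n} \<Longrightarrow> utility m v j (A i) \<le> utility m v j (A j')"
    using A j unfolding ccs_feasible_def by (blast, metis (lifting) Diff_iff mem_Collect_eq order_refl singletonD)
  have "real n * utility m v j (A i) = (\<Sum>j'\<in>{1..n}. utility m v j (A i))"
    by simp
  also have "\<dots> \<le> (\<Sum>j'\<in>{1..n}. utility m v j (A j'))"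
    by (intro sum_mono le)
  also have "\<dots> = (\<Sum>k\<in>{1..m}. v j k * (\<Sum>j'\<in>{1..n}. A j' k))"
    unfolding utility_def sum_distrib_left by (rule sum.swap)
  also have "\<dots> \<le> (\<Sum>k\<in>{1..m}. v j k)"
    using al v j by (intro sum_mono mult_left_le) (auto simp: allocations_def fair_division_instance_def)
  finally show ?thesis .
qed

lemma half_split_allocation:
  assumes B: "\<And>i k. i \<in> I \<Longrightarrow> k \<in> {1..m} \<Longrightarrow> 0 \<le> B i k" and I: "I \<subseteq> {1..n}"
  shows "(\<lambda>i k. 1 / (2 * real n) + (if i \<in> I then B i k / (\<Sum>j\<in>I. B j k) / 2 else 0)) \<in> allocations n m"
    (is "?A \<in> _")
proof -
  have nonneg: "0 \<le> ?A i k" if "k \<in> {1..m}" for i k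
    using B that by (auto intro!: add_nonneg_nonneg divide_nonneg_nonneg sum_nonneg)
  have total: "(\<Sum>i\<in>{1..n}. ?A i k) \<le> 1" for k
  proof -
    have "(\<Sum>i\<in>{1..n}. ?A i k) = n * (1 / (2 * real n)) + (\<Sum>i\<in>I. B i k / (\<Sum>j\<in>I. B j k) / 2)"
      using I by (simp add: sum.distrib sum.If_cases Int_absorb1)
    also have "\<dots> = n * (1 / (2 * real n)) + (\<Sum>i\<in>I. B i k) / (\<Sum>j\<in>I. B j k) / 2"
      by (simp only: sum_divide_distrib)
    \<comment> \<open>The quotient of equal sums is 1, or 0 if nobody in \<open>I\<close> wants the
      item.\<close>
    also have "\<dots> \<le> 1 / 2 + 1 / 2"
      by (intro add_mono) auto
    finally show ?thesis by simp
  qed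
  have "?A i k \<le> 1" if "i \<in> {1..n}" "k \<in> {1..m}" for i k
    using member_le_sum[of i "{1..n}" "\<lambda>i. ?A i k"] nonneg[OF that(2)] total[of k] that(1)
    by (meson finite_atLeastAtMost order_trans DiffE)
  with nonneg total show ?thesis
    by (simp add: allocations_def is_bundle_def)
qed

lemma ccs_sqrt_approximation:
  assumes inst: "fair_division_instance n m v"
  shows "\<exists>A\<in>allocations n m. \<forall>i\<in>{1..n}. utility m v i (A i) \<ge> CCS n m v i / (5 * sqrt (real m))"
proof -
  have n: "n \<ge> 1" and m: "m \<ge> 1" and v: "\<And>i k. i \<in> {1..n} \<Longrightarrow> k \<in> {1..m} \<Longrightarrow> 0 \<le> v i k"
    using inst by (auto simp: fair_division_instance_def)
  have "\<forall>i\<in>{1..n}. \<exists>A\<in>ccs_feasible n m v i. CCS n m v i = utility m v i (A i)"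
    using CCS_is_maximum by blast
  then obtain F where F: "\<And>i. i \<in> {1..n} \<Longrightarrow> F i \<in> ccs_feasible n m v i"
      "\<And>i. i \<in> {1..n} \<Longrightarrow> CCS n m v i = utility m v i (F i i)"
    by (metis (no_types, lifting))
  define B where "B i = F i i" for i
  define T where "T i = (\<Sum>k\<in>{1..m}. v i k)" for i
  \<comment> \<open>Values normalised to total \<open>n\<close>; an agent with
    \<open>T i = 0\<close> gets the zero row, since division by 0 yields 0.\<close>
  define S where "S i k = real n * v i k / T i" for i k
  \<comment> \<open>Chosen so that \<open>L^2 = 2 * m\<close>, which meets the hypothesis of the
    biorthogonality lemma and makes its bound on \<open>card I\<close> exactly what proportional
    sharing requires.\<close>
  define L where "L = sqrt (2 * real m)"
  define c where "c i = (\<Sum>k\<in>{1..m}. S i k * B i k)" for i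
  define I where "I = {i \<in> {1..n}. T i > 0 \<and> c i \<ge> L}"
  define A where "A i k = 1 / (2 * real n) + (if i \<in> I then B i k / (\<Sum>j\<in>I. B j k) / 2 else 0)" for i k
  have I: "I \<subseteq> {1..n}" "finite I" by (auto simp: I_def)
  have L: "L > 0" "L\<^sup>2 = 2 * real m" using m by (auto simp: L_def)
  have B: "0 \<le> B i k \<and> B i k \<le> 1" if "i \<in> {1..n}" "k \<in> {1..m}" for i k
    using F(1)[OF that(1)] that by (auto simp: B_def ccs_feasible_def allocations_def is_bundle_def)
  have T0: "T i \<ge> 0" if "i \<in> {1..n}" for i
    unfolding T_def using v that by (intro sum_nonneg) auto
  have S0: "S i k \<ge> 0" if "i \<in> {1..n}" "k \<in> {1..m}" for i k
    unfolding S_def using v[OF that] T0[OF that(1)] by simp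
  have SX: "(\<Sum>k\<in>{1..m}. S i k * C k) = real n * utility m v i C / T i" for i C
    by (simp add: S_def utility_def sum_distrib_left sum_divide_distrib mult.assoc)
  have cross: "(\<Sum>k\<in>{1..m}. S i k * B j k) \<le> 1"
    if "i \<in> {1..n}" "j \<in> {1..n}" "i \<noteq> j" for i j
    using ccs_feasible_utility_le[OF F(1)[OF that(2)] inst that(2,1,3), folded T_def B_def] T0[OF that(1)]
    unfolding SX by (auto simp: divide_le_eq_1)
  have "real (card I) \<le> 2 * real (card {1..m})"
  proof (rule card_le_if_nearly_biorthogonal[where L = L and S = S and B = B])
    fix i j assume "i \<in> I" "j \<in> I" "i \<noteq> j"
    then show "0 \<le> (\<Sum>k\<in>{1..m}. S i k * B j k) \<and> (\<Sum>k\<in>{1..m}. S i k * B j k) \<le> 1"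
      using cross[of i j] S0 B I by (auto simp: subset_iff intro!: sum_nonneg mult_nonneg_nonneg)
  qed (use I L in \<open>auto simp: I_def c_def\<close>)
  then have cardI: "real (card I) \<le> L\<^sup>2" using L by simp
  have const: "2 * (1 + L) \<le> 5 * sqrt (real m)"
  proof -
    have "sqrt 2 \<le> 3 / 2" by (rule real_le_lsqrt) (auto simp: power2_eq_square)
    then have "L \<le> 3 / 2 * sqrt (real m)"
      unfolding L_def real_sqrt_mult by (intro mult_right_mono) auto
    moreover have "1 \<le> sqrt (real m)" using m by simp
    ultimately show ?thesis by argo
  qed
  have "utility m v i (A i) \<ge> CCS n m v i / (5 * sqrt (real m))" if i: "i \<in> {1..n}" for i
  proof (cases "T i = 0")
    case True
    then have "v i k = 0" if "k \<in> {1..m}" for k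
      using sum_nonneg_0[of "{1..m}" "v i" k] v[OF i] that by (auto simp: T_def)
    then show ?thesis
      by (simp add: F(2)[OF i] utility_def)
  next
    case False
    with T0[OF i] have T: "T i > 0" by simp
    have ccs: "CCS n m v i = T i / n * c i"
      unfolding c_def SX using n T F(2)[OF i] by (simp add: B_def)
    have c0: "c i \<ge> 0"
      unfolding c_def using S0 B i by (intro sum_nonneg mult_nonneg_nonneg) auto
    have uA: "utility m v i (A i) = T i / n * (\<Sum>k\<in>{1..m}. S i k * A i k)"
      unfolding SX using n T by simp
    \<comment> \<open>The equally split half is worth 1/2 to every agent of positive total value; by
      itself it suffices when \<open>c i < L\<close>.\<close>
    have half: "(\<Sum>k\<in>{1..m}. S i k * (1 / (2 * real n))) = 1 / 2"
    proof -
      have "(\<Sum>k\<in>{1..m}. S i k) = n"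
        unfolding S_def sum_divide_distrib[symmetric] sum_distrib_left[symmetric] T_def[symmetric]
        using T by simp
      then show ?thesis
        unfolding sum_distrib_right[symmetric] using n by simp
    qed
    have share: "(\<Sum>k\<in>{1..m}. S i k * A i k) \<ge> c i / (2 * (1 + L))"
    proof (cases "i \<in> I")
      case True
      have "c i / (1 + L) \<le> (\<Sum>k\<in>{1..m}. S i k * (B i k / (\<Sum>j\<in>I. B j k)))"
        unfolding c_def
        by (rule proportional_sharing[OF I(2) _ True])
          (use S0[OF i] B I cross[OF i] True cardI L(1) in \<open>auto simp: I_def c_def\<close>)
      moreover have "(\<Sum>k\<in>{1..m}. S i k * A i k)
          = 1 / 2 + (\<Sum>k\<in>{1..m}. S i k * (B i k / (\<Sum>j\<in>I. B j k))) / 2"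
        using True unfolding half[symmetric]
        by (simp add: A_def distrib_left sum.distrib sum_divide_distrib)
      moreover have "c i / (2 * (1 + L)) = c i / (1 + L) / 2" by simp
      moreover have "x / 2 \<le> 1 / 2 + y / 2" if "x \<le> y" for x y :: real
        using that by simp
      ultimately show ?thesis by presburger
    next
      case False
      then have "c i < L" using i T by (simp add: I_def)
      then have "c i / (2 * (1 + L)) \<le> 1 / 2"
        using L by (simp add: field_simps)
      moreover have "(\<Sum>k\<in>{1..m}. S i k * A i k) = 1 / 2"
        unfolding half[symmetric] using False by (simp add: A_def)
      ultimately show ?thesis by presburger
    qed
    have "CCS n m v i / (5 * sqrt (real m)) \<le> CCS n m v i / (2 * (1 + L))"
      using const L m T c0 by (intro divide_left_mono mult_pos_pos) (auto simp: ccs)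
    also have "\<dots> = T i / n * (c i / (2 * (1 + L)))"
      by (simp add: ccs)
    also have "\<dots> \<le> utility m v i (A i)"
      unfolding uA using share T by (intro mult_left_mono) auto
    finally show ?thesis .
  qed
  moreover have "A \<in> allocations n m"
    using half_split_allocation[of I m B n] B I unfolding A_def by blast
  ultimately show ?thesis by blast
qed

section \<open>Lower bound: instances from affine planes\<close>

lemma CCS_ge:
  assumes "A \<in> ccs_feasible n m v i" "i \<in> {1..n}"
  shows "utility m v i (A i) \<le> CCS n m v i"
  using CCS_is_maximum[OF assms(2), of m v] assms(1) by auto

lemma ccs_sqrt_lower_bound:
  assumes m: "m \<ge> 1"
  shows "\<exists>n v. fair_division_instance n m v \<and>
    (\<forall>\<alpha>::real. \<forall>A\<in>allocations n m.
      \<alpha> \<ge> 1 \<and> (\<forall>i\<in>{1..n}. utility m v i (A i) \<ge> CCS n m v i / \<alpha>) \<longrightarrow> \<alpha> \<ge> 1 / 4 * sqrt (real m))"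
proof (cases "m \<le> 4")
  \<comment> \<open>For \<open>m \<le> 4\<close> the target is at most 1/2, below
    \<open>\<alpha> \<ge> 1\<close>, so any instance will do.\<close>
  case True
  have "sqrt (real m) \<le> 2"
    by (rule real_le_lsqrt) (use True in auto)
  then show ?thesis
    using m by (intro exI[of _ 1] exI[of _ "\<lambda>_ _. 0"]) (auto simp: fair_division_instance_def)
next
  case False
  \<comment> \<open>One item is reserved as filler, so the largest power of 4 up to
    \<open>m - 1\<close> is taken; it will be the number \<open>n = q^2\<close> of points, with
    \<open>m \<le> 4 * n\<close>.\<close>
  obtain k where k: "4 ^ k \<le> m - 1" "m - 1 < 4 ^ (k + 1)"
    using ex_power_ivl1[of 4 "m - 1"] False by fastforce
  have k1: "k \<ge> 1"
    using k False by (cases k) auto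
  define q :: nat where "q = 2 ^ k"
  define n where "n = q\<^sup>2"
  have q2: "q \<ge> 2" using k1 by (cases k) (auto simp: q_def)
  have n4: "n = 4 ^ k" by (simp add: n_def q_def flip: power_mult power_mult_distrib)
      (simp add: power_mult power2_eq_square mult.commute flip: power_mult_distrib)
  have nm: "n + 1 \<le> m" and mn: "m \<le> 4 * n"
    using k False by (auto simp: n4)
  have qn: "2 * q \<le> n" using q2 by (simp add: n_def power2_eq_square)
  obtain R where R: "\<And>i. i \<in> {1..n} \<Longrightarrow> card {p \<in> {1..n}. R i p} = q"
    "\<And>i j. i \<in> {1..n} \<Longrightarrow> j \<in> {1..n} \<Longrightarrow> i \<noteq> j \<Longrightarrow> card {p \<in> {1..n}. R i p \<and> R j p} \<le> 1"
    using affine_plane_exists[OF k1 q_def] unfolding n_def by blast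
  \<comment> \<open>Item \<open>n + 1\<close> is the filler that raises each total from
    \<open>q\<close> to \<open>n\<close>; later items are worthless padding up to
    \<open>m\<close>.\<close>
  define v :: "nat \<Rightarrow> nat \<Rightarrow> real" where
    "v i k = (if k \<le> n then of_bool (R i k) else if k = n + 1 then real n - real q else 0)" for i k
  have inst: "fair_division_instance n m v"
    using qn q2 m by (auto simp: fair_division_instance_def v_def)
  have util: "utility m v i C = (\<Sum>k\<in>{1..n}. of_bool (R i k) * C k) + (real n - real q) * C (n + 1)"
    for i and C :: "nat \<Rightarrow> real"
  proof -
    have "{1..m} = {1..n} \<union> {n + 1} \<union> {n + 2..m}" using nm by auto
    then have "utility m v i C
        = (\<Sum>k\<in>{1..n}. v i k * C k) + v i (n + 1) * C (n + 1) + (\<Sum>k\<in>{n + 2..m}. v i k * C k)"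
      unfolding utility_def by (simp add: sum.union_disjoint)
    also have "(\<Sum>k\<in>{n + 2..m}. v i k * C k) = 0"
      by (intro sum.neutral) (auto simp: v_def)
    also have "(\<Sum>k\<in>{1..n}. v i k * C k) = (\<Sum>k\<in>{1..n}. of_bool (R i k) * C k)"
      by (intro sum.cong) (auto simp: v_def)
    also have "v i (n + 1) = real n - real q"
      by (simp add: v_def)
    finally show ?thesis by simp
  qed
  have ccs: "CCS n m v i \<ge> q" if i: "i \<in> {1..n}" for i
  proof -
    define l :: "nat \<Rightarrow> real" where "l k = of_bool (k \<le> n \<and> R i k)" for k
    \<comment> \<open>Agent \<open>i\<close> takes exactly its own line and the others share the
      rest equally. They value that line at most at 1, hence each equal share at least at
      \<open>(n - 1) / (n - 1) = 1\<close>.\<close>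
    define A where "A j k = (if j = i then l k else (1 - l k) / (real n - 1))" for j k
    have n1: "real n - 1 > 0" using qn q2 by simp
    have ul: "utility m v j l = card {p \<in> {1..n}. R j p \<and> R i p}" for j
    proof -
      have "(\<Sum>k\<in>{1..n}. of_bool (R j k) * l k) = (\<Sum>k\<in>{1..n}. if R j k \<and> R i k then 1 else 0)"
        by (intro sum.cong) (auto simp: l_def)
      also have "\<dots> = card {p \<in> {1..n}. R j p \<and> R i p}"
        by (subst sum.inter_filter[symmetric]) auto
      finally show ?thesis unfolding util by (simp add: l_def)
    qed
    have u1: "utility m v j (\<lambda>_. 1) = n" if "j \<in> {1..n}" for j
      using R(1)[OF that] by (simp add: util of_bool_def sum.inter_filter[symmetric])
    have ur: "utility m v j (\<lambda>k. (1 - l k) / (real n - 1)) = (real n - utility m v j l) / (real n - 1)"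
      if "j \<in> {1..n}" for j
      unfolding u1[OF that, symmetric]
      by (simp add: utility_def algebra_simps sum_subtractf flip: sum_divide_distrib)
    have l01: "0 \<le> l k" "l k \<le> 1" for k by (auto simp: l_def)
    have "(\<Sum>j\<in>{1..n}. A j k) = l k + (\<Sum>j\<in>{1..n} - {i}. (1 - l k) / (real n - 1))" for k
      using i by (simp add: sum.remove[of _ i] A_def)
    then have sumA: "(\<Sum>j\<in>{1..n}. A j k) = 1" for k
      using i n1 by (simp add: of_nat_diff)
    have "(1 - l k) / (real n - 1) \<le> 1" for k
      using l01[of k] qn q2 by (simp add: divide_le_eq_1)
    then have "A \<in> allocations n m"
      using l01 sumA n1 by (auto simp: allocations_def is_bundle_def A_def)
    moreover have "utility m v j (A i) \<le> utility m v j (A j')"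
      if "j \<in> {1..n} - {i}" "j' \<in> {1..n} - {i}" for j j'
    proof -
      have u: "utility m v j l \<le> 1" using R(2)[of j i] that i by (simp add: ul)
      also have "1 \<le> (real n - utility m v j l) / (real n - 1)"
        using u n1 by (simp add: le_divide_eq_1)
      also have "\<dots> = utility m v j (A j')"
        using that ur[of j] by (simp add: A_def[of j', abs_def])
      finally show ?thesis by (simp add: A_def[of i, abs_def])
    qed
    ultimately have "A \<in> ccs_feasible n m v i"
      by (simp add: ccs_feasible_def)
    then have "utility m v i (A i) \<le> CCS n m v i" using i by (rule CCS_ge)
    moreover have "utility m v i (A i) = q"
      using ul[of i] R(1)[OF i] by (simp add: A_def[of i, abs_def])
    ultimately show ?thesis by simp
  qed
  have "\<alpha> \<ge> 1 / 4 * sqrt (real m)"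
    if A: "A \<in> allocations n m" and \<alpha>: "\<alpha> \<ge> 1"
      and u: "\<And>i. i \<in> {1..n} \<Longrightarrow> utility m v i (A i) \<ge> CCS n m v i / \<alpha>" for \<alpha> A
  proof -
    have A0: "0 \<le> A i k" if "i \<in> {1..n}" "k \<in> {1..n + 1}" for i k
      using A that nm by (auto simp: allocations_def is_bundle_def)
    have A1: "(\<Sum>i\<in>{1..n}. A i k) \<le> 1" if "k \<in> {1..n + 1}" for k
      using A that nm by (auto simp: allocations_def)
    have "n * (q / \<alpha>) = (\<Sum>i\<in>{1..n}. q / \<alpha>)" by simp
    also have "\<dots> \<le> (\<Sum>i\<in>{1..n}. utility m v i (A i))"
      using ccs u \<alpha> by (intro sum_mono) (meson divide_right_mono order_trans zero_le_one)
    \<comment> \<open>Each point is worth at most 1 to anyone, so welfare is at most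
      \<open>n\<close> from the points plus \<open>n - q\<close> from the filler.\<close>
    also have "\<dots> \<le> (\<Sum>i\<in>{1..n}. (\<Sum>k\<in>{1..n}. A i k) + (real n - real q) * A i (n + 1))"
      unfolding util using A0 by (intro sum_mono add_right_mono) auto
    also have "\<dots> = (\<Sum>k\<in>{1..n}. \<Sum>i\<in>{1..n}. A i k) + (real n - real q) * (\<Sum>i\<in>{1..n}. A i (n + 1))"
      using sum.swap[of A "{1..n}" "{1..n}"] by (simp add: sum.distrib sum_distrib_left)
    also have "\<dots> \<le> (\<Sum>k\<in>{1..n}. 1) + (real n - real q) * 1"
      using A1 qn q2 by (intro add_mono sum_mono mult_left_mono) auto
    also have "\<dots> \<le> n * 2" by simp
    finally have "q / \<alpha> \<le> 2" using qn q2 by (simp del: times_divide_eq_right)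
    then have "q \<le> 2 * \<alpha>" using \<alpha> by (simp add: field_simps)
    \<comment> \<open>From \<open>m \<le> 4 * q^2\<close>; together with
      \<open>q \<le> 2 * \<alpha>\<close> this yields the constant 1/4.\<close>
    moreover have "sqrt (real m) \<le> 2 * real q"
    proof (rule real_le_lsqrt)
      show "real m \<le> (2 * real q)\<^sup>2"
        using mn by (simp add: n_def power_mult_distrib flip: of_nat_power of_nat_mult)
    qed simp_all
    ultimately show ?thesis by simp
  qed
  with inst show ?thesis by blast
qed

theorem theorem3:
  shows "\<exists>K c :: real. K > 0 \<and> c > 0 \<and>
    (\<forall>m::nat. m \<ge> 1 \<longrightarrow>
      (\<forall>n v. fair_division_instance n m v \<longrightarrow>
        (\<exists>A\<in>allocations n m. \<forall>i\<in>{1..n}.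
           utility m v i (A i) \<ge> 1 / (K * real m powr (2 / 3)) * CCS n m v i)) \<and>
      (\<exists>n v. fair_division_instance n m v \<and>
        (\<forall>\<alpha>::real. \<forall>A\<in>allocations n m.
           \<alpha> \<ge> 1 \<and> (\<forall>i\<in>{1..n}. utility m v i (A i) \<ge> CCS n m v i / \<alpha>) \<longrightarrow>
           \<alpha> \<ge> c * sqrt (real m))))"
proof (rule exI[of _ 5], rule exI[of _ "1 / 4"], intro conjI allI impI)
  fix m n v assume m: "m \<ge> (1::nat)" and inst: "fair_division_instance n m v"
  obtain A where A: "A \<in> allocations n m"
    "\<And>i. i \<in> {1..n} \<Longrightarrow> utility m v i (A i) \<ge> CCS n m v i / (5 * sqrt (real m))"
    using ccs_sqrt_approximation[OF inst] by blast
  have "1 / (5 * real m powr (2 / 3)) * CCS n m v i \<le> utility m v i (A i)" if i: "i \<in> {1..n}" for i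
  proof -
    \<comment> \<open>The empty allocation shows the share to be nonnegative, so enlarging the
      denominator from \<open>sqrt m\<close> to \<open>m powr (2 / 3)\<close> can only weaken the
      guarantee.\<close>
    have "(\<lambda>_ _. 0) \<in> ccs_feasible n m v i"
      by (simp add: ccs_feasible_def allocations_def is_bundle_def utility_def)
    from CCS_ge[OF this i] have "CCS n m v i \<ge> 0" by (simp add: utility_def)
    moreover have "sqrt (real m) \<le> real m powr (2 / 3)"
      using m by (simp add: powr_half_sqrt[symmetric] powr_mono)
    ultimately have "CCS n m v i / (5 * real m powr (2 / 3)) \<le> CCS n m v i / (5 * sqrt (real m))"
      using m by (intro divide_left_mono) auto
    with A(2)[OF i] show ?thesis by simp
  qed
  with A(1) show "\<exists>A\<in>allocations n m. \<forall>i\<in>{1..n}.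
      utility m v i (A i) \<ge> 1 / (5 * real m powr (2 / 3)) * CCS n m v i"
    by blast
next
  fix m :: nat assume "m \<ge> 1"
  then show "\<exists>n v. fair_division_instance n m v \<and>
    (\<forall>\<alpha>::real. \<forall>A\<in>allocations n m.
      \<alpha> \<ge> 1 \<and> (\<forall>i\<in>{1..n}. utility m v i (A i) \<ge> CCS n m v i / \<alpha>) \<longrightarrow> \<alpha> \<ge> 1 / 4 * sqrt (real m))"
    by (rule ccs_sqrt_lower_bound)
qed simp_all

end
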